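(* Let $\Gamma=(U_1,U_2^t)$ be a finite bimatrix game, let $x=(x_1,x_2)$ be a profile of mixed strategies in which at least one player plays a non-pure strategy, let $S(x)=(S_1(x_1),S_2(x_2))$ be its support profile, and let $\Gamma_r$ be the bimatrix game obtained by restricting $(U_1,U_2^t)$ to the rows in $S_1(x_1)$ and the columns in $S_2(x_2)$. (1) If $x$ is a strong Nash equilibrium of $\Gamma$, then all the outcomes of $\Gamma_r$ lie on one straight line in $\mathbb{R}^2$ that has negative slope or is horizontal or vertical; consequently $\Gamma_r$ is either strictly competitive or has all its outcomes on a vertical or horizontal line, and all the outcomes of $\Gamma_r$ are weakly Pareto efficient in $\Gamma_r$. (2) If $x$ is a super strong Nash equilibrium of $\Gamma$, then all the outcomes of $\Gamma_r$ lie on one straight line in $\mathbb{R}^2$ with strictly negative slope; consequently $\Gamma_r$ is strictly competitive, and all the outcomes of $\Gamma_r$ are strictly Pareto efficient in $\Gamma_r$.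
   Context: In the bimatrix game $(U_1,U_2^t)$, $U_1=(u_1^{ij})\in\mathbb{R}^{m_1\times m_2}$ and $U_2=(u_2^{ji})\in\mathbb{R}^{m_2\times m_1}$; a mixed strategy of player $i$ is a vector $x_i$ in the simplex $\Delta_i=\{x_i\in\mathbb{R}^{m_i}: x_i\ge 0,\ \sum_k x_{ik}=1\}$. At the profile $x=(x_1,x_2)$ player 1 gets $v_1(x)=x_1^tU_1x_2$ and player 2 gets $v_2(x)=x_2^tU_2x_1$. The support $S_i(x_i)$ is the set of actions played with strictly positive probability. The outcomes (entries) of the game are the points $u^{ij}=(u_1^{ij},u_2^{ji})\in\mathbb{R}^2$, i.e. the utility pairs of the pure-strategy profiles. A Nash equilibrium is a profile at which no player can strictly increase her own utility by unilaterally changing her mixed strategy. For a coalition $C$ of players (a nonempty subset), a profile $\bar x$ is weakly Pareto efficient for $C$ if there is no profile $y$, with $y_i=\bar x_i$ for all $i\notin C$ and $y_i\in\Delta_i$ arbitrary for $i\in C$, such that $v_i(y)>v_i(\bar x)$ for all $i\in C$. It is strictly Pareto efficient for $C$ if there is no such $y$ with $v_i(y)\ge v_i(\bar x)$ for all $i\in C$ and strict inequality for at least one $i\in C$. A strong (respectively super strong) Nash equilibrium is a Nash equilibrium that is weakly (respectively strictly) Pareto efficient for every coalition. An outcome is weakly (strictly) Pareto efficient in a two-player game if the corresponding pure profile is weakly (strictly) Pareto efficient for the coalition of both players, all mixed profiles of that game being allowed as deviations. A bimatrix game is strictly competitive if, up to a suitable rescaling (a positive affine transformation) of the utility of one player,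 it is zero-sum. *)

theory Defs
  imports "Jordan_Normal_Form.Matrix" "Jordan_Normal_Form.DL_Submatrix"
begin

text \<open>
  The pair (U1, U2) stands for the bimatrix game (U1, U2^t): U1 is indexed by
  (row action, column action) and U2 by (column action, row action), so U1 is an
  m1 x m2 matrix and U2 an m2 x m1 matrix. Actions are numbered from 0.
\<close>

datatype player = P1 | P2

type_synonym bimatrix_game = "real mat \<times> real mat"

type_synonym profile = "player \<Rightarrow> real vec"

definition bimatrix_game :: "nat \<Rightarrow> nat \<Rightarrow> bimatrix_game \<Rightarrow> bool" where
  "bimatrix_game m1 m2 G \<longleftrightarrow> fst G \<in> carrier_mat m1 m2 \<and> snd G \<in> carrier_mat m2 m1"

fun num_actions :: "bimatrix_game \<Rightarrow> player \<Rightarrow> nat" where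
  "num_actions (U1, U2) P1 = dim_row U1"
| "num_actions (U1, U2) P2 = dim_row U2"

definition simplex :: "nat \<Rightarrow> real vec set" where
  "simplex n = {v \<in> carrier_vec n. (\<forall>k<n. v $ k \<ge> 0) \<and> (\<Sum>k<n. v $ k) = 1}"

definition mixed_profiles :: "bimatrix_game \<Rightarrow> profile set" where
  "mixed_profiles G = {x. \<forall>i. x i \<in> simplex (num_actions G i)}"

definition support :: "real vec \<Rightarrow> nat set" where
  "support v = {k. k < dim_vec v \<and> v $ k > 0}"

definition pure_strategy :: "real vec \<Rightarrow> bool" where
  "pure_strategy v \<longleftrightarrow> (\<exists>k < dim_vec v. v = unit_vec (dim_vec v) k)"

fun utility :: "bimatrix_game \<Rightarrow> player \<Rightarrow> profile \<Rightarrow> real" where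
  "utility (U1, U2) P1 x = x P1 \<bullet> (U1 *\<^sub>v x P2)"
| "utility (U1, U2) P2 x = x P2 \<bullet> (U2 *\<^sub>v x P1)"

fun pure_profile :: "bimatrix_game \<Rightarrow> nat \<Rightarrow> nat \<Rightarrow> profile" where
  "pure_profile G a b P1 = unit_vec (num_actions G P1) a"
| "pure_profile G a b P2 = unit_vec (num_actions G P2) b"

fun outcome :: "bimatrix_game \<Rightarrow> nat \<Rightarrow> nat \<Rightarrow> real \<times> real" where
  "outcome (U1, U2) a b = (U1 $$ (a, b), U2 $$ (b, a))"

definition outcomes :: "bimatrix_game \<Rightarrow> (real \<times> real) set" where
  "outcomes G = {outcome G a b | a b. a < num_actions G P1 \<and> b < num_actions G P2}"

lemma outcome_eq_utility_pure_profile: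
  assumes "bimatrix_game m1 m2 G" "a < m1" "b < m2"
  shows "outcome G a b =
    (utility G P1 (pure_profile G a b), utility G P2 (pure_profile G a b))"
  using assms by (cases G) (auto simp: bimatrix_game_def)

definition nash_equilibrium :: "bimatrix_game \<Rightarrow> profile \<Rightarrow> bool" where
  "nash_equilibrium G x \<longleftrightarrow> x \<in> mixed_profiles G \<and>
     \<not> (\<exists>i. \<exists>z \<in> simplex (num_actions G i). utility G i (x(i := z)) > utility G i x)"

definition coalition_deviations :: "bimatrix_game \<Rightarrow> player set \<Rightarrow> profile \<Rightarrow> profile set" where
  "coalition_deviations G C x =
     {y. (\<forall>i. i \<notin> C \<longrightarrow> y i = x i) \<and> (\<forall>i\<in>C. y i \<in> simplex (num_actions G i))}"

definition weakly_pareto_efficient :: "bimatrix_game \<Rightarrow> player set \<Rightarrow> profile \<Rightarrow> bool" where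
  "weakly_pareto_efficient G C x \<longleftrightarrow>
     \<not> (\<exists>y \<in> coalition_deviations G C x. \<forall>i\<in>C. utility G i y > utility G i x)"

definition strictly_pareto_efficient :: "bimatrix_game \<Rightarrow> player set \<Rightarrow> profile \<Rightarrow> bool" where
  "strictly_pareto_efficient G C x \<longleftrightarrow>
     \<not> (\<exists>y \<in> coalition_deviations G C x.
           (\<forall>i\<in>C. utility G i y \<ge> utility G i x) \<and> (\<exists>i\<in>C. utility G i y > utility G i x))"

definition strong_nash :: "bimatrix_game \<Rightarrow> profile \<Rightarrow> bool" where
  "strong_nash G x \<longleftrightarrow> nash_equilibrium G x \<and>
     (\<forall>C. C \<noteq> {} \<longrightarrow> weakly_pareto_efficient G C x)"

definition super_strong_nash :: "bimatrix_game \<Rightarrow> profile \<Rightarrow> bool" where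
  "super_strong_nash G x \<longleftrightarrow> nash_equilibrium G x \<and>
     (\<forall>C. C \<noteq> {} \<longrightarrow> strictly_pareto_efficient G C x)"

definition all_outcomes_weakly_efficient :: "bimatrix_game \<Rightarrow> bool" where
  "all_outcomes_weakly_efficient G \<longleftrightarrow>
     (\<forall>a < num_actions G P1. \<forall>b < num_actions G P2.
        weakly_pareto_efficient G {P1, P2} (pure_profile G a b))"

definition all_outcomes_strictly_efficient :: "bimatrix_game \<Rightarrow> bool" where
  "all_outcomes_strictly_efficient G \<longleftrightarrow>
     (\<forall>a < num_actions G P1. \<forall>b < num_actions G P2.
        strictly_pareto_efficient G {P1, P2} (pure_profile G a b))"

definition zero_sum :: "bimatrix_game \<Rightarrow> bool" where
  "zero_sum G \<longleftrightarrow> snd G = - transpose_mat (fst G)"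

definition strictly_competitive :: "bimatrix_game \<Rightarrow> bool" where
  "strictly_competitive G \<longleftrightarrow>
     (\<exists>c>0. \<exists>d. zero_sum (map_mat (\<lambda>u. c * u + d) (fst G), snd G)
             \<or> zero_sum (fst G, map_mat (\<lambda>u. c * u + d) (snd G)))"

fun restrict_game :: "bimatrix_game \<Rightarrow> nat set \<Rightarrow> nat set \<Rightarrow> bimatrix_game" where
  "restrict_game (U1, U2) S1 S2 = (submatrix U1 S1 S2, submatrix U2 S2 S1)"

definition negative_slope_line :: "(real \<times> real) set \<Rightarrow> bool" where
  "negative_slope_line L \<longleftrightarrow> (\<exists>s<0. \<exists>c. L = {(u, w). w = s * u + c})"

definition horizontal_line :: "(real \<times> real) set \<Rightarrow> bool" where
  "horizontal_line L \<longleftrightarrow> (\<exists>c. L = {(u, w). w = c})"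

definition vertical_line :: "(real \<times> real) set \<Rightarrow> bool" where
  "vertical_line L \<longleftrightarrow> (\<exists>c. L = {(u, w). u = c})"

end

theory Submission
  imports Defs
begin

text \<open>
  Perturb the equilibrium (p, q) to (p + \<epsilon> d, q + \<epsilon> e), where d and e have zero sum and live on
  the supports. By the Nash conditions player 1 gains \<epsilon> \<alpha>(e) + \<epsilon>^2 A(d, e) and player 2 gains
  \<epsilon> \<beta>(d) + \<epsilon>^2 B(d, e), with \<alpha>, \<beta> linear and A, B bilinear. As d and e are independent, weak
  efficiency forbids \<alpha> and \<beta> from both being nonzero. If only \<alpha> is nonzero, B must vanish, so
  player 2's payoff is constant on the support. If both vanish, A B \<le> 0 everywhere, which forces
  A = 0 or B = - s A with s \<ge> 0. Every entry of the restricted game is obtained by taking d and e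
  to be the differences of vertices with p and q, so these alternatives are the three kinds of
  lines. Under strict efficiency a payoff that is constant on the support makes the other one
  constant as well: its equilibrium value is a weighted average of its entries, and a pure profile
  with an entry above that average would be an improvement.
\<close>

section \<open>Bilinear forms and functionals on directions\<close>

text \<open>Strategies and directions are both plain functions, so a perturbed strategy can be
  expanded by linearity. For mixed \<open>d\<close> and \<open>e\<close> this is the expected
  payoff.\<close>

definition bform :: "nat \<Rightarrow> nat \<Rightarrow> (nat \<Rightarrow> nat \<Rightarrow> real) \<Rightarrow> (nat \<Rightarrow> real) \<Rightarrow> (nat \<Rightarrow> real) \<Rightarrow> real" where
  "bform n m u d e = (\<Sum>i<n. \<Sum>j<m. d i * u i j * e j)"

text \<open>
  Instead of vector space structure on functions, we use the single operation d + t d'; negation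
  is its instance d + (-2) d.
\<close>

definition additive_on_lines :: "((nat \<Rightarrow> real) \<Rightarrow> real) \<Rightarrow> bool" where
  "additive_on_lines f \<longleftrightarrow> (\<forall>d d' t. f (\<lambda>k. d k + t * d' k) = f d + t * f d')"

definition line_closed :: "(nat \<Rightarrow> real) set \<Rightarrow> bool" where
  "line_closed D \<longleftrightarrow> (\<forall>d\<in>D. \<forall>d'\<in>D. \<forall>t. (\<lambda>k. d k + t * d' k) \<in> D)"

lemma additive_on_linesD:
  "additive_on_lines f \<Longrightarrow> f (\<lambda>k. d k + t * d' k) = f d + t * f d'"
  by (simp add: additive_on_lines_def)

lemma line_closedD:
  "line_closed D \<Longrightarrow> d \<in> D \<Longrightarrow> d' \<in> D \<Longrightarrow> (\<lambda>k. d k + t * d' k) \<in> D"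
  by (simp add: line_closed_def)

lemma additive_on_lines_uminus:
  assumes "additive_on_lines f"
  shows "f (\<lambda>k. d k + (-2) * d k) = - f d"
  using additive_on_linesD[OF assms, of d "-2" d] by simp

lemma bform_linear:
  "additive_on_lines (\<lambda>d. bform n m u d e)" "additive_on_lines (bform n m u d)"
  by (simp_all add: additive_on_lines_def bform_def sum_distrib_left algebra_simps
      flip: sum.distrib)

lemma bform_add_left: "bform n m u (\<lambda>k. d k + t * d' k) e = bform n m u d e + t * bform n m u d' e"
  using additive_on_linesD[OF bform_linear(1)] .

lemma bform_add_right: "bform n m u d (\<lambda>k. e k + t * e' k) = bform n m u d e + t * bform n m u d e'"
  using additive_on_linesD[OF bform_linear(2)] .

section \<open>Functionals and forms whose product is never positive\<close>

text \<open>Correct \<open>d\<close> by a multiple of \<open>d0\<close> to get \<open>h\<close> with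
  \<open>f h = 0\<close>. If \<open>g h\<close> were nonzero, then along \<open>h + t d0\<close> the
  product would be t (f d0) (g h) plus a term in t^2, hence positive for a small t of the right
  sign.\<close>

lemma proportional_functionals:
  assumes f: "additive_on_lines f" and g: "additive_on_lines g" and D: "line_closed D"
    and sgn: "\<And>d. d \<in> D \<Longrightarrow> f d * g d \<le> 0"
    and d0: "d0 \<in> D" "f d0 \<noteq> 0" and d: "d \<in> D"
  shows "g d = (g d0 / f d0) * f d"
proof -
  define h where "h = (\<lambda>k. d k + (- (f d / f d0)) * d0 k)"
  have h: "h \<in> D" unfolding h_def using line_closedD[OF D d d0(1)] .
  have fh: "f h = 0" using d0(2) unfolding h_def additive_on_linesD[OF f] by simp
  have gh: "g h = g d - (f d / f d0) * g d0" unfolding h_def additive_on_linesD[OF g] by simp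
  have "g h = 0"
  proof (rule ccontr)
    assume nz: "g h \<noteq> 0"
    define p where "p = f d0 * g d0"
    define r where "r = f d0 * g h"
    \<comment> \<open>With t = r / c the product t r + t^2 p equals r^2 (c + p) / c^2. This choice
      of \<open>c\<close> keeps c + p positive.\<close>
    define c where "c = 1 + \<bar>p\<bar>"
    have c: "c > 0" "c + p > 0" unfolding c_def by auto
    define t where "t = r / c"
    have "(\<lambda>k. h k + t * d0 k) \<in> D" using line_closedD[OF D h d0(1)] .
    then have "f (\<lambda>k. h k + t * d0 k) * g (\<lambda>k. h k + t * d0 k) \<le> 0" by (rule sgn)
    then have "(t * f d0) * (g h + t * g d0) \<le> 0"
      using fh by (simp add: additive_on_linesD[OF f] additive_on_linesD[OF g])
    then have "t * r + t * t * p \<le> 0" by (simp add: p_def r_def algebra_simps)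
    then have "r * r * (c + p) / (c * c) \<le> 0"
      using c(1) by (simp add: t_def field_simps)
    moreover have "r * r > 0" using nz d0(2) by (simp add: r_def flip: power2_eq_square)
    then have "r * r * (c + p) / (c * c) > 0"
      by (rule divide_pos_pos[OF mult_pos_pos[OF _ c(2)] mult_pos_pos[OF c(1) c(1)]])
    ultimately show False by linarith
  qed
  then show ?thesis using gh by (simp add: field_simps)
qed

text \<open>Fix \<open>d0\<close>, \<open>e0\<close> with \<open>A d0 e0\<close> nonzero.
  Proportionality in the second argument gives one ratio along the row of \<open>d0\<close>;
  proportionality in the first argument then carries it to every \<open>d\<close>. The sign
  condition at (\<open>d0\<close>, \<open>e0\<close>) makes this ratio nonpositive.\<close>

lemma proportional_bilinear_forms:
  assumes A: "\<And>e. additive_on_lines (\<lambda>d. A d e)" "\<And>d. additive_on_lines (A d)"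
    and B: "\<And>e. additive_on_lines (\<lambda>d. B d e)" "\<And>d. additive_on_lines (B d)"
    and D: "line_closed D" and E: "line_closed E"
    and sgn: "\<And>d e. d \<in> D \<Longrightarrow> e \<in> E \<Longrightarrow> A d e * B d e \<le> 0"
  shows "(\<forall>d\<in>D. \<forall>e\<in>E. A d e = 0) \<or> (\<exists>s\<ge>0. \<forall>d\<in>D. \<forall>e\<in>E. B d e = - s * A d e)"
proof (rule disjCI)
  assume "\<not> (\<exists>s\<ge>0. \<forall>d\<in>D. \<forall>e\<in>E. B d e = - s * A d e)"
  then have no: "\<And>s. s \<ge> 0 \<Longrightarrow> \<not> (\<forall>d\<in>D. \<forall>e\<in>E. B d e = - s * A d e)" by blast
  show "\<forall>d\<in>D. \<forall>e\<in>E. A d e = 0"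
  proof (rule ccontr)
    assume "\<not> (\<forall>d\<in>D. \<forall>e\<in>E. A d e = 0)"
    then obtain d0 e0 where d0: "d0 \<in> D" and e0: "e0 \<in> E" and nz: "A d0 e0 \<noteq> 0" by blast
    define q where "q = B d0 e0 / A d0 e0"
    have row: "B d0 e = q * A d0 e" if "e \<in> E" for e
      unfolding q_def by (rule proportional_functionals[OF A(2) B(2) E sgn[OF d0] e0 nz that])
    have col: "B d e = q * A d e" if "d \<in> D" "e \<in> E" "A d0 e \<noteq> 0" for d e
    proof -
      have "B d e = (B d0 e / A d0 e) * A d e"
        by (rule proportional_functionals[OF A(1) B(1) D _ d0 that(3,1)]) (rule sgn[OF _ that(2)])
      then show ?thesis using row[OF that(2)] that(3) by simp
    qed
    have "B d e = q * A d e" if de: "d \<in> D" "e \<in> E" for d e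
    proof (cases "A d0 e = 0")
      case True
      \<comment> \<open>Adding \<open>e0\<close> makes the value at \<open>d0\<close> nonzero, so
        \<open>col\<close> applies; linearity then removes the contribution of
        \<open>e0\<close>.\<close>
      let ?e = "\<lambda>k. e k + 1 * e0 k"
      have "?e \<in> E" using line_closedD[OF E de(2) e0] .
      moreover have "A d0 ?e \<noteq> 0" using True nz by (subst additive_on_linesD[OF A(2)]) simp
      ultimately have "B d ?e = q * A d ?e" using col de(1) by blast
      moreover have "B d e0 = q * A d e0" using col de(1) e0 nz by blast
      ultimately show ?thesis
        unfolding additive_on_linesD[OF A(2)] additive_on_linesD[OF B(2)] by (simp add: algebra_simps)
    qed (use col de in blast)
    moreover have "q \<le> 0" using sgn[OF d0 e0] nz unfolding q_def
      by (auto simp: divide_le_0_iff mult_le_0_iff)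
    ultimately show False using no[of "- q"] by simp
  qed
qed

section \<open>Consequences of excluding joint ascent\<close>

text \<open>Negating \<open>d\<close> does not affect \<open>\<alpha> e\<close>, so \<open>B\<close>
  vanishes wherever \<open>\<alpha>\<close> is positive. Every \<open>e\<close> is a combination of
  two such directions, \<open>e + t e0\<close> and \<open>e0\<close>.\<close>

lemma second_order_form_vanishes:
  assumes B: "\<And>e. additive_on_lines (\<lambda>d. B d e)" "\<And>d. additive_on_lines (B d)"
    and \<alpha>: "additive_on_lines \<alpha>"
    and D: "line_closed D" and E: "line_closed E"
    and no: "\<And>d e. d \<in> D \<Longrightarrow> e \<in> E \<Longrightarrow> \<alpha> e > 0 \<Longrightarrow> B d e \<le> 0"
    and e0: "e0 \<in> E" "\<alpha> e0 > 0" and d: "d \<in> D" and e: "e \<in> E"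
  shows "B d e = 0"
proof -
  have zero: "B d e' = 0" if "e' \<in> E" "\<alpha> e' > 0" for e'
  proof -
    have "B (\<lambda>k. d k + (-2) * d k) e' \<le> 0" using no[OF line_closedD[OF D d d] that] .
    then have "- B d e' \<le> 0" unfolding additive_on_lines_uminus[OF B(1)] .
    then show ?thesis using no[OF d that] by simp
  qed
  \<comment> \<open>This makes \<open>\<alpha> ?e\<close> equal to
    \<open>\<alpha> e + 1 + \<bar>\<alpha> e\<bar>\<close>, which is positive.\<close>
  define t where "t = (1 + \<bar>\<alpha> e\<bar>) / \<alpha> e0"
  let ?e = "\<lambda>k. e k + t * e0 k"
  have "\<alpha> ?e > 0"
    using e0(2) unfolding additive_on_linesD[OF \<alpha>] by (simp add: t_def)
  then have "B d ?e = 0" using zero line_closedD[OF E e e0(1)] by blast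
  then show ?thesis using zero[OF e0] by (simp add: additive_on_linesD[OF B(2)])
qed

text \<open>The pairs (\<open>\<alpha>\<close>, \<open>A\<close>) and (\<open>\<beta>\<close>,
  \<open>B\<close>) are the first and second order coefficients of the two gains. Premise
  \<open>no\<close> excludes that both gains are positive for small steps. The conclusion speaks of
  the gains at step size one, which is the step that reaches vertices.\<close>

lemma no_joint_ascent_cases:
  assumes A: "\<And>e. additive_on_lines (\<lambda>d. A d e)" "\<And>d. additive_on_lines (A d)"
    and B: "\<And>e. additive_on_lines (\<lambda>d. B d e)" "\<And>d. additive_on_lines (B d)"
    and \<alpha>: "additive_on_lines \<alpha>" and \<beta>: "additive_on_lines \<beta>"
    and D: "line_closed D" and E: "line_closed E"
    and no: "\<And>d e. d \<in> D \<Longrightarrow> e \<in> E \<Longrightarrow> \<alpha> e > 0 \<or> (\<alpha> e = 0 \<and> A d e > 0)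
               \<Longrightarrow> \<beta> d > 0 \<or> (\<beta> d = 0 \<and> B d e > 0) \<Longrightarrow> False"
  shows "(\<forall>d\<in>D. \<forall>e\<in>E. \<alpha> e + A d e = 0) \<or> (\<forall>d\<in>D. \<forall>e\<in>E. \<beta> d + B d e = 0)
       \<or> (\<exists>s>0. \<forall>d\<in>D. \<forall>e\<in>E. \<beta> d + B d e = - s * (\<alpha> e + A d e))"
proof -
  have pos: "\<exists>d\<in>D. f d > 0" if f: "additive_on_lines f" and D: "line_closed D" and d: "d \<in> D" "f d \<noteq> 0"
    for f D and d :: "nat \<Rightarrow> real"
  proof (cases "f d > 0")
    case False
    then have "f (\<lambda>k. d k + (-2) * d k) > 0"
      using d(2) unfolding additive_on_lines_uminus[OF f] by simp
    then show ?thesis using line_closedD[OF D d(1) d(1)] by blast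
  qed (use d in blast)
  consider (neither) "\<forall>e\<in>E. \<alpha> e = 0" "\<forall>d\<in>D. \<beta> d = 0"
    | (first) e0 where "e0 \<in> E" "\<alpha> e0 > 0" "\<forall>d\<in>D. \<beta> d = 0"
    | (second) d0 where "d0 \<in> D" "\<beta> d0 > 0" "\<forall>e\<in>E. \<alpha> e = 0"
    | (both) d0 e0 where "d0 \<in> D" "\<beta> d0 > 0" "e0 \<in> E" "\<alpha> e0 > 0"
    using pos[OF \<alpha> E] pos[OF \<beta> D] by metis
  then show ?thesis
  proof cases
    case neither
    have sgn: "A d e * B d e \<le> 0" if de: "d \<in> D" "e \<in> E" for d e
    proof (rule ccontr)
      assume "\<not> A d e * B d e \<le> 0"
      then consider "A d e > 0" "B d e > 0" | "A d e < 0" "B d e < 0"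
        by (auto simp: not_le zero_less_mult_iff)
      then show False
      proof cases
        case 2
        \<comment> \<open>The first order terms vanish identically in this case, and negating
          \<open>e\<close> turns two negative second order terms into two positive ones.\<close>
        let ?e = "\<lambda>k. e k + (-2) * e k"
        have "A d ?e > 0" "B d ?e > 0"
          unfolding additive_on_lines_uminus[OF A(2)] additive_on_lines_uminus[OF B(2)]
          using 2 by simp_all
        moreover have "?e \<in> E" using line_closedD[OF E de(2) de(2)] .
        ultimately show False using no[OF de(1)] neither de by blast
      qed (use no[OF de] neither de in blast)
    qed
    have "(\<forall>d\<in>D. \<forall>e\<in>E. A d e = 0) \<or> (\<exists>s\<ge>0. \<forall>d\<in>D. \<forall>e\<in>E. B d e = - s * A d e)"
      by (rule proportional_bilinear_forms[OF A B D E]) (rule sgn)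
    then show ?thesis
    proof (elim disjE exE conjE)
      fix s :: real assume "s \<ge> 0" "\<forall>d\<in>D. \<forall>e\<in>E. B d e = - s * A d e"
      then show ?thesis using neither by (cases "s = 0") (simp, intro disjI2 exI[of _ s], simp)
    qed (use neither in auto)
  next
    case first
    have "B d e \<le> 0" if "d \<in> D" "e \<in> E" "\<alpha> e > 0" for d e
      using no[OF that(1,2)] that first(3) by force
    then have "B d e = 0" if "d \<in> D" "e \<in> E" for d e
      using second_order_form_vanishes[OF B \<alpha> D E _ first(1,2) that] by blast
    then show ?thesis using first(3) by simp
  next
    case second
    have "A d e \<le> 0" if "e \<in> E" "d \<in> D" "\<beta> d > 0" for d e
      using no[OF that(2,1)] that second(3) by force
    \<comment> \<open>The players are exchanged here, so \<open>A\<close> enters the lemma with its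
      arguments swapped.\<close>
    then have "A d e = 0" if "e \<in> E" "d \<in> D" for d e
      using second_order_form_vanishes[OF A(2,1) \<beta> E D _ second(1,2) that] by blast
    then show ?thesis using second(3) by simp
  next
    case both
    then show ?thesis using no by blast
  qed
qed

section \<open>Small perturbations of a mixed strategy\<close>

text \<open>For \<open>p\<close> in the simplex these are the tangent directions of the smallest
  face containing \<open>p\<close>. Unlike the cone of all feasible directions, they are closed
  under negation.\<close>

definition directions :: "nat \<Rightarrow> (nat \<Rightarrow> real) \<Rightarrow> (nat \<Rightarrow> real) set" where
  "directions n p = {d. (\<forall>k<n. p k = 0 \<longrightarrow> d k = 0) \<and> (\<Sum>k<n. d k) = 0}"

lemma line_closed_directions: "line_closed (directions n p)"
  by (auto simp: line_closed_def directions_def sum.distrib simp flip: sum_distrib_left)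

text \<open>Positive coordinates stay positive by continuity, zero coordinates do not move, and the
  total is unchanged.\<close>

lemma eventually_perturbed_in_simplex:
  assumes p: "vec n p \<in> simplex n" and d: "d \<in> directions n p"
  shows "\<forall>\<^sub>F \<epsilon> in at_right 0. vec n (\<lambda>k. p k + \<epsilon> * d k) \<in> simplex n"
proof -
  have "\<forall>\<^sub>F \<epsilon> in at_right 0. 0 \<le> p k + \<epsilon> * d k" if k: "k < n" for k
  proof (cases "p k = 0")
    case True
    then show ?thesis using d k by (simp add: directions_def)
  next
    case False
    then have "p k > 0" using p k by (auto simp: simplex_def order.strict_iff_order)
    moreover have "((\<lambda>\<epsilon>. p k + \<epsilon> * d k) \<longlongrightarrow> p k + 0 * d k) (at_right 0)"
      by (intro tendsto_intros)
    ultimately have "\<forall>\<^sub>F \<epsilon> in at_right 0. p k + \<epsilon> * d k > 0"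
      using order_tendstoD(1) by fastforce
    then show ?thesis by (rule eventually_mono) simp
  qed
  then have "\<forall>\<^sub>F \<epsilon> in at_right 0. \<forall>k\<in>{..<n}. 0 \<le> p k + \<epsilon> * d k"
    by (intro eventually_ball_finite) auto
  then show ?thesis
    by (rule eventually_mono)
      (use p d in \<open>auto simp: simplex_def directions_def sum.distrib simp flip: sum_distrib_left\<close>)
qed

lemma eventually_quadratic_pos:
  fixes a b :: real
  assumes "a > 0 \<or> (a = 0 \<and> b > 0)"
  shows "\<forall>\<^sub>F \<epsilon> in at_right 0. \<epsilon> * a + \<epsilon> * (\<epsilon> * b) > 0"
proof -
  have ev: "\<forall>\<^sub>F \<epsilon> in at_right 0. (0::real) < \<epsilon>" by (rule eventually_at_right_less)
  have "\<forall>\<^sub>F \<epsilon> in at_right 0. a + \<epsilon> * b > 0"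
  proof (cases "a > 0")
    case True
    moreover have "((\<lambda>\<epsilon>. a + \<epsilon> * b) \<longlongrightarrow> a + 0 * b) (at_right 0)"
      by (intro tendsto_intros)
    ultimately show ?thesis using order_tendstoD(1) by fastforce
  next
    case False
    then show ?thesis using assms ev by (auto elim: eventually_mono)
  qed
  with ev show ?thesis
  proof eventually_elim
    case (elim \<epsilon>)
    then have "\<epsilon> * (a + \<epsilon> * b) > 0" by simp
    then show ?case by (simp add: algebra_simps)
  qed
qed

lemma sum_of_bool_mult: "i < (n::nat) \<Longrightarrow> (\<Sum>k<n. of_bool (k = i) * f k) = (f i :: real)"
proof -
  assume "i < n"
  have eq: "(\<lambda>k. of_bool (k = i) * f k) = (\<lambda>k. if k = i then f k else 0)" by auto
  show ?thesis unfolding eq using \<open>i < n\<close> by simp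
qed

lemma bform_unit:
  "i < n \<Longrightarrow> j < m \<Longrightarrow> bform n m u (\<lambda>k. of_bool (k = i)) (\<lambda>k. of_bool (k = j)) = u i j"
proof -
  assume "i < n" "j < m"
  have "bform n m u (\<lambda>k. of_bool (k = i)) (\<lambda>k. of_bool (k = j)) =
     (\<Sum>k<n. of_bool (k = i) * (\<Sum>l<m. of_bool (l = j) * u k l))"
    by (simp only: bform_def sum_distrib_left mult_ac)
  then show ?thesis using \<open>i < n\<close> \<open>j < m\<close> by (simp only: sum_of_bool_mult)
qed

text \<open>A full step from \<open>p\<close> along this direction lands on the pure strategy
  \<open>i\<close>. The shape with \<open>(-1) *\<close> is the one that
  \<open>bform_add_left\<close> rewrites.\<close>

lemma vertex_direction:
  assumes "vec n p \<in> simplex n" "i < n" "p i > 0"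
  shows "(\<lambda>k. of_bool (k = i) + (-1) * p k) \<in> directions n p"
proof -
  have "(\<Sum>k<n. of_bool (k = i) :: real) = 1" using sum_of_bool_mult[of i n "\<lambda>_. 1"] assms(2) by simp
  then show ?thesis using assms by (auto simp: directions_def simplex_def sum.distrib sum_negf sum_subtractf)
qed

text \<open>The vertices are \<open>p + d\<close> and \<open>q + e\<close>, so the entry is the form
  expanded around (\<open>p\<close>, \<open>q\<close>).\<close>

lemma entry_expansion:
  assumes "i < n" "j < m"
    and d: "d = (\<lambda>k. of_bool (k = i) + (-1) * p k)" and e: "e = (\<lambda>k. of_bool (k = j) + (-1) * q k)"
  shows "u i j = bform n m u p q + bform n m u d q + (bform n m u p e + bform n m u d e)"
  unfolding d e bform_add_left bform_add_right bform_unit[OF assms(1,2)] by simp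

section \<open>Entries on the support of an efficient equilibrium\<close>

lemma efficient_equilibrium_entries:
  assumes p: "vec n p \<in> simplex n" and q: "vec m q \<in> simplex m"
    and nash1: "\<And>p'. vec n p' \<in> simplex n \<Longrightarrow> bform n m u p' q \<le> bform n m u p q"
    and nash2: "\<And>q'. vec m q' \<in> simplex m \<Longrightarrow> bform n m w p q' \<le> bform n m w p q"
    and eff: "\<And>p' q'. vec n p' \<in> simplex n \<Longrightarrow> vec m q' \<in> simplex m \<Longrightarrow>
        bform n m u p' q' > bform n m u p q \<Longrightarrow> bform n m w p' q' > bform n m w p q \<Longrightarrow> False"
    and I: "I = {i. i < n \<and> p i > 0}" and J: "J = {j. j < m \<and> q j > 0}"
  shows "(\<exists>c. \<forall>i\<in>I. \<forall>j\<in>J. u i j = c) \<or> (\<exists>c. \<forall>i\<in>I. \<forall>j\<in>J. w i j = c)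
     \<or> (\<exists>s>0. \<exists>c. \<forall>i\<in>I. \<forall>j\<in>J. w i j = - s * u i j + c)"
proof -
  let ?D = "directions n p" and ?E = "directions m q"
  let ?u = "bform n m u" and ?w = "bform n m w"
  \<comment> \<open>At a maximum over the simplex a linear functional cannot increase along any
    direction of the face; applying this to the negated direction as well gives zero.\<close>
  have first_order: "f d = 0"
    if f: "additive_on_lines f" and r: "vec l r \<in> simplex l"
      and max: "\<And>r'. vec l r' \<in> simplex l \<Longrightarrow> f r' \<le> f r" and d: "d \<in> directions l r" for f l r d
  proof -
    have le: "f d \<le> 0" if "d \<in> directions l r" for d
    proof -
      have "\<forall>\<^sub>F \<epsilon> in at_right 0. \<epsilon> * f d \<le> 0 \<and> 0 < \<epsilon>"
        using eventually_perturbed_in_simplex[OF r that] eventually_at_right_less[of "0::real"]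
      proof eventually_elim
        case (elim \<epsilon>)
        then show ?case using max[OF elim(1)] by (simp add: additive_on_linesD[OF f])
      qed
      then have "\<exists>\<epsilon>>0. \<epsilon> * f d \<le> 0" using eventually_happens'[OF trivial_limit_at_right_real] by blast
      then show ?thesis by (auto simp: mult_le_0_iff)
    qed
    have "- f d \<le> 0"
      using le[OF line_closedD[OF line_closed_directions d d, of "-2"]]
      unfolding additive_on_lines_uminus[OF f] .
    then show ?thesis using le[OF d] by simp
  qed
  have u0: "?u d q = 0" if "d \<in> ?D" for d
    using first_order[OF bform_linear(1) p nash1 that] .
  have w0: "?w p e = 0" if "e \<in> ?E" for e
    using first_order[OF bform_linear(2) q nash2 that] .
  have no: False
    if de: "d \<in> ?D" "e \<in> ?E" and a: "?u p e > 0 \<or> (?u p e = 0 \<and> ?u d e > 0)"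
      and b: "?w d q > 0 \<or> (?w d q = 0 \<and> ?w d e > 0)" for d e
  proof -
    \<comment> \<open>Feasibility and both gains hold together for small positive steps,
      contradicting \<open>eff\<close>; the filter is nontrivial, so this is absurd.\<close>
    have "\<forall>\<^sub>F \<epsilon> in at_right (0::real). False"
      using eventually_perturbed_in_simplex[OF p de(1)] eventually_perturbed_in_simplex[OF q de(2)]
        eventually_quadratic_pos[OF a] eventually_quadratic_pos[OF b]
    proof eventually_elim
      case (elim \<epsilon>)
      show False
        by (rule eff[OF elim(1,2)])
          (use elim(3,4) u0[OF de(1)] w0[OF de(2)] in
            \<open>simp_all add: bform_add_left bform_add_right algebra_simps\<close>)
    qed
    then show False by (simp add: trivial_limit_at_right_real)
  qed
  \<comment> \<open>In the expansion of each entry the effect of a player's own move alone,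
    \<open>?u d q\<close> or \<open>?w p e\<close>, vanishes.\<close>
  have entries: "\<exists>d\<in>?D. \<exists>e\<in>?E. u i j = ?u p q + (?u p e + ?u d e) \<and> w i j = ?w p q + (?w d q + ?w d e)"
    if "i \<in> I" "j \<in> J" for i j
  proof -
    have ij: "i < n" "j < m" "p i > 0" "q j > 0" using that by (auto simp: I J)
    note d = vertex_direction[OF p ij(1,3)] and e = vertex_direction[OF q ij(2,4)]
    show ?thesis
      by (rule bexI[OF bexI[OF _ e] d])
        (use u0[OF d] w0[OF e] entry_expansion[OF ij(1,2) refl refl, of u p q]
          entry_expansion[OF ij(1,2) refl refl, of w p q] in linarith)
  qed
  have "(\<forall>d\<in>?D. \<forall>e\<in>?E. ?u p e + ?u d e = 0) \<or> (\<forall>d\<in>?D. \<forall>e\<in>?E. ?w d q + ?w d e = 0)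
     \<or> (\<exists>s>0. \<forall>d\<in>?D. \<forall>e\<in>?E. ?w d q + ?w d e = - s * (?u p e + ?u d e))"
    by (rule no_joint_ascent_cases[OF bform_linear bform_linear bform_linear(2) bform_linear(1)
      line_closed_directions line_closed_directions]) (rule no)
  then show ?thesis
  proof (elim disjE exE conjE)
    assume "\<forall>d\<in>?D. \<forall>e\<in>?E. ?u p e + ?u d e = 0"
    then have "\<forall>i\<in>I. \<forall>j\<in>J. u i j = ?u p q" using entries by fastforce
    then show ?thesis by blast
  next
    assume "\<forall>d\<in>?D. \<forall>e\<in>?E. ?w d q + ?w d e = 0"
    then have "\<forall>i\<in>I. \<forall>j\<in>J. w i j = ?w p q" using entries by fastforce
    then show ?thesis by blast
  next
    fix s :: real
    assume s: "s > 0" and eq: "\<forall>d\<in>?D. \<forall>e\<in>?E. ?w d q + ?w d e = - s * (?u p e + ?u d e)"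
    \<comment> \<open>The intercept is that of the line of slope -s through the equilibrium payoffs
      (\<open>?u p q\<close>, \<open>?w p q\<close>).\<close>
    have "w i j = - s * u i j + (?w p q + s * ?u p q)" if ij: "i \<in> I" "j \<in> J" for i j
    proof -
      obtain d e where de: "d \<in> ?D" "e \<in> ?E" "u i j = ?u p q + (?u p e + ?u d e)"
        "w i j = ?w p q + (?w d q + ?w d e)" using entries[OF ij] by blast
      then have "?w d q + ?w d e = - s * (?u p e + ?u d e)" using eq by blast
      then show ?thesis unfolding de(3,4) by (simp add: algebra_simps)
    qed
    then show ?thesis using s by blast
  qed
qed

section \<open>Payoffs as weighted averages of entries\<close>

lemma bform_const:
  assumes "vec n p \<in> simplex n" "vec m q \<in> simplex m"
  shows "bform n m (\<lambda>_ _. c) p q = c"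
proof -
  have "bform n m (\<lambda>_ _. c) p q = (\<Sum>i<n. \<Sum>j<m. c * (p i * q j))"
    by (simp add: bform_def mult_ac)
  also have "\<dots> = c * ((\<Sum>i<n. p i) * (\<Sum>j<m. q j))"
    unfolding sum_product by (simp only: sum_distrib_left)
  finally show ?thesis using assms by (simp add: simplex_def)
qed

lemma bform_affine:
  assumes "vec n p \<in> simplex n" "vec m q \<in> simplex m"
    and "\<And>i j. i < n \<Longrightarrow> j < m \<Longrightarrow> w i j = s * u i j + c"
  shows "bform n m w p q = s * bform n m u p q + c"
proof -
  have "bform n m w p q = s * bform n m u p q + bform n m (\<lambda>_ _. c) p q"
    using assms(3) by (simp add: bform_def sum_distrib_left algebra_simps flip: sum.distrib)
  then show ?thesis using bform_const[OF assms(1,2)] by simp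
qed

text \<open>The gaps between the average and the entries have weighted sum zero. On the support they
  are nonnegative with positive weight, and elsewhere the weight is zero, so each gap on the support
  vanishes.\<close>

lemma entries_eq_average:
  assumes p: "vec n p \<in> simplex n" and q: "vec m q \<in> simplex m"
    and I: "I = {i. i < n \<and> p i > 0}" and J: "J = {j. j < m \<and> q j > 0}"
    and le: "\<And>i j. i \<in> I \<Longrightarrow> j \<in> J \<Longrightarrow> u i j \<le> bform n m u p q"
    and ij: "i \<in> I" "j \<in> J"
  shows "u i j = bform n m u p q"
proof -
  let ?v = "bform n m u p q"
  let ?g = "\<lambda>i j. p i * (?v - u i j) * q j"
  have nonneg: "?g i j \<ge> 0" if "i < n" "j < m" for i j
  proof (cases "i \<in> I \<and> j \<in> J")
    case True
    then show ?thesis using le by (auto simp: I J)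
  next
    case False
    then have "p i = 0 \<or> q j = 0" using p q that by (force simp: I J simplex_def)
    then show ?thesis by auto
  qed
  have "bform n m (\<lambda>i j. ?v - u i j) p q = - 1 * bform n m u p q + ?v"
    by (rule bform_affine[OF p q]) simp
  then have z: "(\<Sum>i<n. \<Sum>j<m. ?g i j) = 0" by (simp add: bform_def)
  have "i < n" "j < m" using ij by (auto simp: I J)
  have "(\<Sum>j<m. ?g i j) = 0"
    using z \<open>i < n\<close> nonneg by (subst (asm) sum_nonneg_eq_0_iff) (auto intro!: sum_nonneg)
  then have "?g i j = 0"
    using \<open>i < n\<close> \<open>j < m\<close> nonneg by (subst (asm) sum_nonneg_eq_0_iff) auto
  then show ?thesis using ij by (simp add: I J)
qed

section \<open>Profiles and efficiency in terms of forms\<close>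

lemma simplex_vec: "v \<in> simplex n \<Longrightarrow> v = vec n (($) v)"
  by (auto simp: simplex_def)

lemma utility_bform:
  assumes "U1 \<in> carrier_mat n m" "U2 \<in> carrier_mat m n" "y P1 = vec n p" "y P2 = vec m q"
  shows "utility (U1, U2) P1 y = bform n m (\<lambda>i j. U1 $$ (i, j)) p q"
    and "utility (U1, U2) P2 y = bform n m (\<lambda>i j. U2 $$ (j, i)) p q"
proof -
  show "utility (U1, U2) P1 y = bform n m (\<lambda>i j. U1 $$ (i, j)) p q"
    using assms by (simp add: bform_def scalar_prod_def sum_distrib_left mult_ac lessThan_atLeast0)
  have "utility (U1, U2) P2 y = (\<Sum>j<m. \<Sum>i<n. p i * U2 $$ (j, i) * q j)"
    using assms by (simp add: scalar_prod_def sum_distrib_left mult_ac lessThan_atLeast0)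
  then show "utility (U1, U2) P2 y = bform n m (\<lambda>i j. U2 $$ (j, i)) p q"
    unfolding bform_def by (subst sum.swap)
qed

lemma UNIV_player: "(UNIV :: player set) = {P1, P2}"
  using player.exhaust by auto

lemma deviations_grand_coalition: "coalition_deviations G {P1, P2} x = mixed_profiles G"
  by (auto simp: coalition_deviations_def mixed_profiles_def simp flip: UNIV_player)

lemma weakly_efficient_grand_coalition:
  "weakly_pareto_efficient G {P1, P2} x \<longleftrightarrow>
     (\<forall>y\<in>mixed_profiles G. \<not> (utility G P1 y > utility G P1 x \<and> utility G P2 y > utility G P2 x))"
  by (simp add: weakly_pareto_efficient_def deviations_grand_coalition)

lemma strictly_efficient_grand_coalition:
  "strictly_pareto_efficient G {P1, P2} x \<longleftrightarrow>
     (\<forall>y\<in>mixed_profiles G. \<not> (utility G P1 y \<ge> utility G P1 x \<and> utility G P2 y \<ge> utility G P2 x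
        \<and> (utility G P1 y > utility G P1 x \<or> utility G P2 y > utility G P2 x)))"
  unfolding strictly_pareto_efficient_def deviations_grand_coalition by simp

lemma all_players: "(\<forall>i::player. P i) \<longleftrightarrow> P P1 \<and> P P2"
  by (metis player.exhaust)

lemma unit_vec_simplex: "k < n \<Longrightarrow> unit_vec n k \<in> simplex n"
  by (auto simp: simplex_def unit_vec_def)

lemma pure_profile_mixed:
  "a < num_actions G P1 \<Longrightarrow> b < num_actions G P2 \<Longrightarrow> pure_profile G a b \<in> mixed_profiles G"
  by (simp add: mixed_profiles_def all_players unit_vec_simplex)

lemma mixed_profile_vec:
  assumes "U1 \<in> carrier_mat n m" "U2 \<in> carrier_mat m n" "y \<in> mixed_profiles (U1, U2)"
  shows "y P1 \<in> simplex n" "y P2 \<in> simplex m"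
    "y P1 = vec n (($) (y P1))" "y P2 = vec m (($) (y P2))"
  using assms simplex_vec by (auto simp: mixed_profiles_def all_players)

section \<open>Games with affinely related or constant payoffs\<close>

lemma utility_affine:
  assumes U: "U1 \<in> carrier_mat n m" "U2 \<in> carrier_mat m n"
    and aff: "\<And>i j. i < n \<Longrightarrow> j < m \<Longrightarrow> U2 $$ (j, i) = s * U1 $$ (i, j) + c"
    and y: "y \<in> mixed_profiles (U1, U2)"
  shows "utility (U1, U2) P2 y = s * utility (U1, U2) P1 y + c"
proof -
  note v = mixed_profile_vec[OF U y]
  show ?thesis unfolding utility_bform[OF U v(3,4)]
    by (rule bform_affine) (use v aff in auto)
qed

text \<open>The affine relation passes from entries to all mixed profiles, so any gain of one player
  is a loss of the other.\<close>

lemma negative_slope_game: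
  assumes U: "U1 \<in> carrier_mat n m" "U2 \<in> carrier_mat m n" and s: "s > 0"
    and aff: "\<And>i j. i < n \<Longrightarrow> j < m \<Longrightarrow> U2 $$ (j, i) = - s * U1 $$ (i, j) + c"
  shows "\<exists>L. negative_slope_line L \<and> outcomes (U1, U2) \<subseteq> L"
    and "strictly_competitive (U1, U2)"
    and "all_outcomes_strictly_efficient (U1, U2)"
proof -
  have "outcomes (U1, U2) \<subseteq> {(u, w). w = - s * u + c}"
    using U aff by (auto simp: outcomes_def)
  moreover have "negative_slope_line {(u, w). w = - s * u + c}"
    unfolding negative_slope_line_def using s by (intro exI[of _ "- s"]) auto
  ultimately show "\<exists>L. negative_slope_line L \<and> outcomes (U1, U2) \<subseteq> L" by blast
  \<comment> \<open>Since w = -(s u - c), rescaling player 1's payoff to s u - c makes the game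
    zero-sum.\<close>
  have "zero_sum (map_mat (\<lambda>u. s * u + (- c)) U1, U2)"
    unfolding zero_sum_def fst_conv snd_conv
    by (rule eq_matI) (use U in \<open>simp_all add: aff\<close>)
  then show "strictly_competitive (U1, U2)"
    unfolding strictly_competitive_def fst_conv snd_conv using s by blast
  have lin: "utility (U1, U2) P2 y = - s * utility (U1, U2) P1 y + c"
    if "y \<in> mixed_profiles (U1, U2)" for y
    by (rule utility_affine[OF U _ that]) (rule aff)
  have anti: "\<not> (a \<ge> b \<and> - s * a + c \<ge> - s * b + c \<and> (a > b \<or> - s * a + c > - s * b + c))" for a b
    using s by auto
  have "\<not> (utility (U1, U2) P1 y \<ge> utility (U1, U2) P1 z \<and> utility (U1, U2) P2 y \<ge> utility (U1, U2) P2 z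
      \<and> (utility (U1, U2) P1 y > utility (U1, U2) P1 z \<or> utility (U1, U2) P2 y > utility (U1, U2) P2 z))"
    if "y \<in> mixed_profiles (U1, U2)" "z \<in> mixed_profiles (U1, U2)" for y z
    unfolding lin[OF that(1)] lin[OF that(2)] by (rule anti)
  then show "all_outcomes_strictly_efficient (U1, U2)"
    unfolding all_outcomes_strictly_efficient_def strictly_efficient_grand_coalition
    using pure_profile_mixed[of _ "(U1, U2)"] by blast
qed

lemma strictly_imp_weakly_pareto_efficient:
  "C \<noteq> {} \<Longrightarrow> strictly_pareto_efficient G C x \<Longrightarrow> weakly_pareto_efficient G C x"
  unfolding strictly_pareto_efficient_def weakly_pareto_efficient_def
  by (meson all_not_in_conv less_imp_le)

lemma all_outcomes_strictly_imp_weakly_efficient: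
  "all_outcomes_strictly_efficient G \<Longrightarrow> all_outcomes_weakly_efficient G"
  by (simp add: all_outcomes_strictly_efficient_def all_outcomes_weakly_efficient_def
      strictly_imp_weakly_pareto_efficient)

lemma constant_payoff_weakly_efficient:
  assumes "\<And>y. y \<in> mixed_profiles G \<Longrightarrow> utility G i y = c"
  shows "all_outcomes_weakly_efficient G"
proof -
  have "\<not> (utility G P1 y > utility G P1 z \<and> utility G P2 y > utility G P2 z)"
    if "y \<in> mixed_profiles G" "z \<in> mixed_profiles G" for y z
    using assms[OF that(1)] assms[OF that(2)] by (cases i) auto
  then show ?thesis
    unfolding all_outcomes_weakly_efficient_def weakly_efficient_grand_coalition
    using pure_profile_mixed[of _ G] by blast
qed

section \<open>The restricted game and the two claims\<close>

lemma submatrix_entries: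
  assumes "U \<in> carrier_mat n m" "S \<subseteq> {..<n}" "T \<subseteq> {..<m}"
  shows "submatrix U S T \<in> carrier_mat (card S) (card T)"
    and "i < card S \<Longrightarrow> j < card T \<Longrightarrow> submatrix U S T $$ (i, j) = U $$ (pick S i, pick T j)"
proof -
  have eq: "{i. i < dim_row U \<and> i \<in> S} = S" "{j. j < dim_col U \<and> j \<in> T} = T"
    using assms by auto
  show "submatrix U S T \<in> carrier_mat (card S) (card T)"
    using dim_submatrix[of U S T] unfolding eq by (intro carrier_matI) auto
  show "i < card S \<Longrightarrow> j < card T \<Longrightarrow> submatrix U S T $$ (i, j) = U $$ (pick S i, pick T j)"
    using submatrix_index[of i U S j T] unfolding eq by blast
qed

theorem mainTheorem2:
  fixes U1 U2 :: "real mat" and m1 m2 :: nat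
    and G Gr :: bimatrix_game and x :: profile
  assumes "G = (U1, U2)"
    and "bimatrix_game m1 m2 G"
    and "x \<in> mixed_profiles G"
    and "\<exists>i. \<not> pure_strategy (x i)"
    and "Gr = restrict_game G (support (x P1)) (support (x P2))"
  shows "(strong_nash G x \<longrightarrow>
            (\<exists>L. (negative_slope_line L \<or> horizontal_line L \<or> vertical_line L) \<and> outcomes Gr \<subseteq> L)
          \<and> (strictly_competitive Gr
              \<or> (\<exists>L. (vertical_line L \<or> horizontal_line L) \<and> outcomes Gr \<subseteq> L))
          \<and> all_outcomes_weakly_efficient Gr)
       \<and> (super_strong_nash G x \<longrightarrow>
            (\<exists>L. negative_slope_line L \<and> outcomes Gr \<subseteq> L)
          \<and> strictly_competitive Gr
          \<and> all_outcomes_strictly_efficient Gr)"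
proof -
  define u where "u = (\<lambda>i j. U1 $$ (i, j))"
  define w where "w = (\<lambda>i j. U2 $$ (j, i))"
  define p where "p = ($) (x P1)"
  define q where "q = ($) (x P2)"
  have U: "U1 \<in> carrier_mat m1 m2" "U2 \<in> carrier_mat m2 m1"
    using assms(1,2) by (auto simp: bimatrix_game_def)
  note xv = mixed_profile_vec[OF U, folded assms(1), OF assms(3), folded p_def q_def]
  have p: "vec m1 p \<in> simplex m1" and q: "vec m2 q \<in> simplex m2" using xv by auto
  define I where "I = support (x P1)"
  define J where "J = support (x P2)"
  have I: "I = {i. i < m1 \<and> p i > 0}" and J: "J = {j. j < m2 \<and> q j > 0}"
    using xv(1,2) by (auto simp: I_def J_def support_def simplex_def p_def q_def)
  have Isub: "I \<subseteq> {..<m1}" and Jsub: "J \<subseteq> {..<m2}" by (auto simp: I J)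
  define V1 where "V1 = submatrix U1 I J"
  define V2 where "V2 = submatrix U2 J I"
  have Gr: "Gr = (V1, V2)" using assms(1,5) by (simp add: V1_def V2_def I_def J_def)
  note V = submatrix_entries(1)[OF U(1) Isub Jsub, folded V1_def]
    submatrix_entries(1)[OF U(2) Jsub Isub, folded V2_def]
  \<comment> \<open>\<open>pick\<close> enumerates the support, translating the renumbered actions
    of the restricted game into those of the original one.\<close>
  have pick: "pick I i \<in> I" "pick J j \<in> J" if "i < card I" "j < card J" for i j
    using that pick_in_set by auto
  have V1: "V1 $$ (i, j) = u (pick I i) (pick J j)" and V2: "V2 $$ (j, i) = w (pick I i) (pick J j)"
    if "i < card I" "j < card J" for i j
    using submatrix_entries(2)[OF U(1) Isub Jsub that] submatrix_entries(2)[OF U(2) Jsub Isub that(2,1)]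
    by (simp_all add: V1_def V2_def u_def w_def)
  define prof :: "(nat \<Rightarrow> real) \<Rightarrow> (nat \<Rightarrow> real) \<Rightarrow> profile" where
    "prof = (\<lambda>p q i. case i of P1 \<Rightarrow> vec m1 p | P2 \<Rightarrow> vec m2 q)"
  have util: "utility G P1 y = bform m1 m2 u p' q'" "utility G P2 y = bform m1 m2 w p' q'"
    if "y P1 = vec m1 p'" "y P2 = vec m2 q'" for y p' q'
    using utility_bform[OF U, of y p' q'] that by (simp_all add: assms(1) u_def w_def)
  have util_prof: "utility G P1 (prof p' q') = bform m1 m2 u p' q'"
    "utility G P2 (prof p' q') = bform m1 m2 w p' q'" for p' q'
    by (rule util; simp add: prof_def)+
  have n: "num_actions G P1 = m1" "num_actions G P2 = m2" using U by (simp_all add: assms(1))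
  have mixed: "prof p' q' \<in> mixed_profiles G" if "vec m1 p' \<in> simplex m1" "vec m2 q' \<in> simplex m2" for p' q'
    using that n by (simp add: mixed_profiles_def all_players prof_def)
  \<comment> \<open>Serves both the sloped case of the first claim and the whole second
    claim.\<close>
  have neg_slope_goal: "(\<exists>L. negative_slope_line L \<and> outcomes Gr \<subseteq> L) \<and> strictly_competitive Gr
      \<and> all_outcomes_strictly_efficient Gr"
    if "s > 0" "\<forall>i\<in>I. \<forall>j\<in>J. w i j = - s * u i j + c" for s c
    using negative_slope_game[OF V that(1), of c] that(2) V1 V2 pick unfolding Gr by simp
  have cases: "(\<exists>c. \<forall>i\<in>I. \<forall>j\<in>J. u i j = c) \<or> (\<exists>c. \<forall>i\<in>I. \<forall>j\<in>J. w i j = c)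
     \<or> (\<exists>s>0. \<exists>c. \<forall>i\<in>I. \<forall>j\<in>J. w i j = - s * u i j + c)" if strong: "strong_nash G x"
  proof (rule efficient_equilibrium_entries[OF p q _ _ _ I J])
    have nash: "\<not> utility G i (x(i := z)) > utility G i x" if "z \<in> simplex (num_actions G i)" for i z
      using strong that unfolding strong_nash_def nash_equilibrium_def by blast
    show "bform m1 m2 u p' q \<le> bform m1 m2 u p q" if "vec m1 p' \<in> simplex m1" for p'
      using nash[of "vec m1 p'" P1] that xv(3,4) n
        util(1)[of "x(P1 := vec m1 p')" p' q] util(1)[of x p q] by simp
    show "bform m1 m2 w p q' \<le> bform m1 m2 w p q" if "vec m2 q' \<in> simplex m2" for q'
      using nash[of "vec m2 q'" P2] that xv(3,4) n
        util(2)[of "x(P2 := vec m2 q')" p q'] util(2)[of x p q] by simp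
    have weff: "weakly_pareto_efficient G {P1, P2} x" using strong by (simp add: strong_nash_def)
    show False if "vec m1 p' \<in> simplex m1" "vec m2 q' \<in> simplex m2"
      "bform m1 m2 u p' q' > bform m1 m2 u p q" "bform m1 m2 w p' q' > bform m1 m2 w p q" for p' q'
      using bspec[OF weff[unfolded weakly_efficient_grand_coalition] mixed[OF that(1,2)]] that(3,4)
      unfolding util_prof util[OF xv(3,4)] by blast
  qed
  have weak: "(\<exists>L. (negative_slope_line L \<or> horizontal_line L \<or> vertical_line L) \<and> outcomes Gr \<subseteq> L)
          \<and> (strictly_competitive Gr
              \<or> (\<exists>L. (vertical_line L \<or> horizontal_line L) \<and> outcomes Gr \<subseteq> L))
          \<and> all_outcomes_weakly_efficient Gr" if strong: "strong_nash G x"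
    using cases[OF strong]
  proof (elim disjE exE conjE)
    fix c assume c: "\<forall>i\<in>I. \<forall>j\<in>J. u i j = c"
    have "utility Gr P1 y = c" if y: "y \<in> mixed_profiles Gr" for y
    proof -
      note v = mixed_profile_vec[OF V, folded Gr, OF y]
      \<comment> \<open>With slope 0 and the zero form, \<open>bform_affine\<close> evaluates a form
        with constant entries.\<close>
      show ?thesis unfolding Gr utility_bform[OF V v(3,4)]
        using bform_affine[of _ "($) (y P1)" _ "($) (y P2)" _ 0 "\<lambda>_ _. 0" c] v c pick V1 by simp
    qed
    then have "all_outcomes_weakly_efficient Gr" by (rule constant_payoff_weakly_efficient)
    moreover have "outcomes Gr \<subseteq> {(u, w). u = c}"
      using V c V1 pick by (auto simp: Gr outcomes_def)
    moreover have "vertical_line {(u, w). u = c}" unfolding vertical_line_def by blast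
    ultimately show ?thesis by blast
  next
    fix c assume c: "\<forall>i\<in>I. \<forall>j\<in>J. w i j = c"
    have "utility Gr P2 y = c" if y: "y \<in> mixed_profiles Gr" for y
    proof -
      have "utility Gr P2 y = 0 * utility Gr P1 y + c"
        unfolding Gr by (rule utility_affine[OF V]) (use c pick V2 y Gr in auto)
      then show ?thesis by simp
    qed
    then have "all_outcomes_weakly_efficient Gr" by (rule constant_payoff_weakly_efficient)
    moreover have "outcomes Gr \<subseteq> {(u, w). w = c}"
      using V c V2 pick by (auto simp: Gr outcomes_def)
    moreover have "horizontal_line {(u, w). w = c}" unfolding horizontal_line_def by blast
    ultimately show ?thesis by blast
  next
    fix s c :: real assume "s > 0" "\<forall>i\<in>I. \<forall>j\<in>J. w i j = - s * u i j + c"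
    from neg_slope_goal[OF this] show ?thesis
      using all_outcomes_strictly_imp_weakly_efficient by blast
  qed
  have "(\<exists>L. negative_slope_line L \<and> outcomes Gr \<subseteq> L) \<and> strictly_competitive Gr
      \<and> all_outcomes_strictly_efficient Gr" if super: "super_strong_nash G x"
  proof -
    have strong: "strong_nash G x"
      using super unfolding super_strong_nash_def strong_nash_def
      by (simp add: strictly_imp_weakly_pareto_efficient)
    have seff: "strictly_pareto_efficient G {P1, P2} x" using super by (simp add: super_strong_nash_def)
    have eff: "\<not> (bform m1 m2 u p' q' \<ge> bform m1 m2 u p q \<and> bform m1 m2 w p' q' \<ge> bform m1 m2 w p q
        \<and> (bform m1 m2 u p' q' > bform m1 m2 u p q \<or> bform m1 m2 w p' q' > bform m1 m2 w p q))"
      if "vec m1 p' \<in> simplex m1" "vec m2 q' \<in> simplex m2" for p' q'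
      using bspec[OF seff[unfolded strictly_efficient_grand_coalition] mixed[OF that]]
      unfolding util_prof util[OF xv(3,4)] .
    \<comment> \<open>Pure profiles are deviations of the grand coalition, so strict efficiency
      compares single entries with the equilibrium payoffs.\<close>
    have eff_pure: "\<not> (u i j \<ge> bform m1 m2 u p q \<and> w i j \<ge> bform m1 m2 w p q
        \<and> (u i j > bform m1 m2 u p q \<or> w i j > bform m1 m2 w p q))" if "i \<in> I" "j \<in> J" for i j
    proof -
      have ij: "i < m1" "j < m2" using that by (auto simp: I J)
      have "vec k (\<lambda>l. of_bool (l = h)) \<in> simplex k" if "h < k" for h k
        using unit_vec_simplex[OF that] by (simp add: unit_vec_def of_bool_def)
      from eff[OF this[OF ij(1)] this[OF ij(2)]] show ?thesis unfolding bform_unit[OF ij] .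
    qed
    have avg: "bform m1 m2 f p q = c" if "\<forall>i\<in>I. \<forall>j\<in>J. f i j = c" for f c
    proof -
      have "p i * f i j * q j = p i * c * q j" if "i < m1" "j < m2" for i j
      proof (cases "i \<in> I \<and> j \<in> J")
        case False
        then have "p i = 0 \<or> q j = 0" using p q that by (force simp: I J simplex_def)
        then show ?thesis by auto
      qed (use \<open>\<forall>i\<in>I. \<forall>j\<in>J. f i j = c\<close> in simp)
      then have "bform m1 m2 f p q = bform m1 m2 (\<lambda>_ _. c) p q"
        unfolding bform_def by (intro sum.cong refl) (simp only: lessThan_iff)
      then show ?thesis using bform_const[OF p q] by simp
    qed
    have "\<exists>s>0. \<exists>c. \<forall>i\<in>I. \<forall>j\<in>J. w i j = - s * u i j + c"
      using cases[OF strong]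
    proof (elim disjE exE)
      fix c assume c: "\<forall>i\<in>I. \<forall>j\<in>J. u i j = c"
      \<comment> \<open>Player 1 is indifferent among these entries, so one above player 2's average
        would be an improvement.\<close>
      have "w i j \<le> bform m1 m2 w p q" if "i \<in> I" "j \<in> J" for i j
        using eff_pure[OF that] c that avg[OF c] by force
      then have "w i j = bform m1 m2 w p q" if "i \<in> I" "j \<in> J" for i j
        using entries_eq_average[OF p q I J _ that] by blast
      \<comment> \<open>Both payoffs are constant, so the support yields a single outcome and any
        negative slope fits; -1 is taken.\<close>
      then show ?thesis using c by (intro exI[of _ 1] conjI exI[of _ "bform m1 m2 w p q + c"]) auto
    next
      fix c assume c: "\<forall>i\<in>I. \<forall>j\<in>J. w i j = c"
      have "u i j \<le> bform m1 m2 u p q" if "i \<in> I" "j \<in> J" for i j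
        using eff_pure[OF that] c that avg[OF c] by force
      then have "u i j = bform m1 m2 u p q" if "i \<in> I" "j \<in> J" for i j
        using entries_eq_average[OF p q I J _ that] by blast
      then show ?thesis using c by (intro exI[of _ 1] conjI exI[of _ "bform m1 m2 u p q + c"]) auto
    qed blast
    then show ?thesis using neg_slope_goal by blast
  qed
  with weak show ?thesis by blast
qed

end
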